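(* Let $p$ be a finite prime. Let $f \in \mathbb{Q}[z]$ be a monic polynomial of degree $d \geq 2$, and let $r$ be the radius of the minimal closed disk in $\mathbb{C}_p$ containing the filled Julia set $\mathcal{K}_{f,p}$. For any point $x_0 \in \mathcal{K}_{f,p}$, the following containments hold: $$\mathcal{K}_{f,p} \subset \bigcup_{x \in \mathbb{C}_p,\ f(x) = x_0} D(x, 1) \qquad \text{and} \qquad \mathcal{K}_{f,p} \subset \bigcup_{x \in \mathbb{C}_p,\ f^2(x) = x_0} D(x, r^{-1/d}).$$
   Context: For a prime number $p$, $\mathbb{C}_p$ is the completion of an algebraic closure of $\mathbb{Q}_p$, with absolute value $|\cdot|_p$ extending the standard one on $\mathbb{Q}_p$ (normalized by $|p|_p = 1/p$). For $a \in \mathbb{C}_p$ and $s>0$, $D(a,s) = \{x \in \mathbb{C}_p : |x-a|_p \leq s\}$ is the closed disk of radius $s$. $f^n$ denotes the $n$-th iterate of $f$ (so $f^2 = f\circ f$). The filled Julia set of $f$ at $p$ is $$\mathcal{K}_{f,p} = \{x \in \mathbb{C}_p : f^n(x) \not\to \infty \text{ as } n \to \infty\}.$$ *)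

theory Defs
  imports "HOL-Analysis.Analysis" "HOL-Computational_Algebra.Computational_Algebra"
begin

section \<open>Absolute values and completions\<close>

definition absolute_value :: "('a::field \<Rightarrow> real) \<Rightarrow> bool" where
  "absolute_value v \<longleftrightarrow>
     (\<forall>x. 0 \<le> v x) \<and> (\<forall>x. v x = 0 \<longleftrightarrow> x = 0) \<and>
     (\<forall>x y. v (x * y) = v x * v y) \<and> (\<forall>x y. v (x + y) \<le> v x + v y)"

abbreviation av_dist :: "('a::field \<Rightarrow> real) \<Rightarrow> 'a \<Rightarrow> 'a \<Rightarrow> real" where
  "av_dist v \<equiv> \<lambda>x y. v (x - y)"

definition is_subfield :: "'a::field set \<Rightarrow> bool" where
  "is_subfield F \<longleftrightarrow> 0 \<in> F \<and> 1 \<in> F \<and>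
     (\<forall>x\<in>F. \<forall>y\<in>F. x + y \<in> F \<and> x - y \<in> F \<and> x * y \<in> F) \<and> (\<forall>x\<in>F. inverse x \<in> F)"

definition is_completion :: "('a::field \<Rightarrow> real) \<Rightarrow> 'a set \<Rightarrow> 'a set \<Rightarrow> bool" where
  "is_completion v F E \<longleftrightarrow> is_subfield F \<and> is_subfield E \<and> F \<subseteq> E \<and>
     Metric_space.mcomplete E (av_dist v) \<and>
     Metric_space.mtopology E (av_dist v) closure_of F = E"

definition is_algebraic_closure :: "'a::field set \<Rightarrow> 'a set \<Rightarrow> bool" where
  "is_algebraic_closure F E \<longleftrightarrow> is_subfield F \<and> is_subfield E \<and> F \<subseteq> E \<and>
     (\<forall>x\<in>E. \<exists>P. P \<noteq> 0 \<and> (\<forall>i. coeff P i \<in> F) \<and> poly P x = 0) \<and>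
     (\<forall>P. degree P > 0 \<and> (\<forall>i. coeff P i \<in> E) \<longrightarrow> (\<exists>x\<in>E. poly P x = 0))"

section \<open>The field of p-adic complex numbers\<close>

definition padic_abs :: "nat \<Rightarrow> rat \<Rightarrow> real" where
  "padic_abs p q = (if q = 0 then 0 else
     real p powi (int (multiplicity (int p) (snd (quotient_of q)))
                - int (multiplicity (int p) (fst (quotient_of q)))))"

text \<open>
  The field of $p$-adic complex numbers is unique only up to isometric isomorphism, so it is
  given by a predicate: the whole type \<open>'a\<close>, with the absolute value \<open>v\<close>, is a completion of an
  algebraic closure \<open>Qp_bar\<close> of a completion \<open>Qp\<close> of the rationals, all realised as subfields of
  \<open>'a\<close>. The set \<open>\<rat>\<close> is the prime field of \<open>'a\<close>, and \<open>v\<close> is the usual $p$-adic absolute value on it.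
\<close>

definition is_padic_complex :: "nat \<Rightarrow> ('a::field_char_0 \<Rightarrow> real) \<Rightarrow> bool" where
  "is_padic_complex p v \<longleftrightarrow> absolute_value v \<and> (\<forall>q. v (of_rat q) = padic_abs p q) \<and>
     (\<exists>Qp Qp_bar. is_completion v \<rat> Qp \<and> is_algebraic_closure Qp Qp_bar \<and>
        is_completion v Qp_bar UNIV)"

section \<open>Disks and filled Julia sets\<close>

definition closed_disk :: "('a::field \<Rightarrow> real) \<Rightarrow> 'a \<Rightarrow> real \<Rightarrow> 'a set" where
  "closed_disk v a s = {x. v (x - a) \<le> s}"

definition filled_julia :: "('a::field \<Rightarrow> real) \<Rightarrow> ('a \<Rightarrow> 'a) \<Rightarrow> 'a set" where
  "filled_julia v f = {x. \<not> filterlim (\<lambda>n. v ((f ^^ n) x)) at_top sequentially}"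

text \<open>
  The value group of the $p$-adic complex numbers is dense in the positive reals, so a closed disk
  of positive radius, as a set, determines its radius (but not its centre).
\<close>

definition is_min_disk_radius :: "('a::field \<Rightarrow> real) \<Rightarrow> 'a set \<Rightarrow> real \<Rightarrow> bool" where
  "is_min_disk_radius v S r \<longleftrightarrow> r > 0 \<and>
     (\<exists>a. S \<subseteq> closed_disk v a r \<and>
        (\<forall>b s. s > 0 \<and> S \<subseteq> closed_disk v b s \<longrightarrow> closed_disk v a r \<subseteq> closed_disk v b s))"

end

theory Submission
  imports Defs
begin

text \<open>
  Let \<open>K\<close> be the filled Julia set; both inclusions are immediate if \<open>r \<le> 1\<close>, since \<open>K\<close> has diameter
  at most \<open>r\<close> and contains all preimages of its points. Let \<open>r > 1\<close>, let \<open>w \<in> K\<close>, and let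
  \<open>y\<^sub>1, \<dots>, y\<^sub>d\<close> be the roots of \<open>f y = w\<close>. If all of them had distance at most \<open>s < r\<close> from some
  \<open>x \<in> K\<close>, then any \<open>z\<close> with \<open>|z - x| > s\<close> would satisfy \<open>|f z - w| \<ge> |z - x|\<^sup>d\<close>, so that \<open>K\<close> would
  lie in the disk around \<open>x\<close> of radius \<open>max s (r powr (1/d)) < r\<close>. Hence some factor of
  \<open>|f x - w| = |x - y\<^sub>1| \<dots> |x - y\<^sub>d|\<close> is at least \<open>r\<close>, and some other one, \<open>|x - y|\<close>, satisfies
  \<open>|x - y|^(d-1) \<le> |f x - w| / r\<close>. With \<open>w = x\<^sub>0\<close> this gives the first inclusion; with \<open>w\<close> a preimage
  of \<open>x\<^sub>0\<close> at distance at most 1 from \<open>f x\<close> it gives the second one.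
\<close>

section \<open>Inequalities for products of nonnegative reals\<close>

lemma prod_list_ge_power:
  fixes xs :: "real list"
  assumes "0 \<le> m" "\<And>x. x \<in> set xs \<Longrightarrow> m \<le> x"
  shows "m ^ length xs \<le> prod_list xs"
  using assms by (induction xs) (auto intro!: mult_mono intro: order_trans)

lemma prod_list_ge_power_elem:
  fixes xs :: "real list"
  assumes "xs \<noteq> []" "\<forall>x\<in>set xs. 0 \<le> x"
  shows "\<exists>x\<in>set xs. x ^ length xs \<le> prod_list xs"
proof
  show "Min (set xs) \<in> set xs" using assms by (intro Min_in) auto
  then show "Min (set xs) ^ length xs \<le> prod_list xs"
    using assms by (intro prod_list_ge_power) auto
qed

text \<open>Splitting off a factor that is at least \<open>r\<close> leaves a nonempty product of at
  most \<open>prod_list xs / r\<close>, and the least remaining factor does not exceed the geometric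
  mean.\<close>

lemma prod_list_remove_elem:
  fixes xs :: "real list"
  assumes "length xs \<ge> 2" "\<forall>x\<in>set xs. 0 \<le> x"
    and "y \<in> set xs" "0 < r" "r \<le> y"
  shows "\<exists>x\<in>set xs. x ^ (length xs - 1) \<le> prod_list xs / r"
proof -
  obtain us ws where xs: "xs = us @ y # ws" using assms(3) by (meson split_list)
  have "us @ ws \<noteq> []" using assms(1) xs by auto
  then obtain x where x: "x \<in> set (us @ ws)" "x ^ length (us @ ws) \<le> prod_list (us @ ws)"
    using prod_list_ge_power_elem[of "us @ ws"] assms(2) xs by auto
  have "0 \<le> prod_list (us @ ws)"
    using assms(2) xs by (intro prod_list_nonneg) auto
  then have "r * prod_list (us @ ws) \<le> y * prod_list (us @ ws)"
    using assms(5) by (intro mult_right_mono) auto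
  then have "prod_list (us @ ws) \<le> prod_list xs / r"
    using assms(4) by (simp add: xs field_simps)
  with x show ?thesis by (intro bexI[of _ x]) (auto simp: xs)
qed

text \<open>Exponential growth beats linear growth. This removes the factor n + 1 that the binomial
  expansion leaves in \<open>ultrametric\<close>.\<close>

lemma powers_le_linear_imp_le_1:
  fixes c :: real
  assumes "0 \<le> c" "\<And>n. c ^ n \<le> real n + 1"
  shows "c \<le> 1"
proof (rule ccontr)
  assume "\<not> c \<le> 1"
  then have c: "norm (1 / c) < 1" by simp
  have "(\<lambda>n. of_nat n * (1/c) ^ n + (1/c) ^ n) \<longlonglongrightarrow> 0 + 0"
    using c by (intro tendsto_add powser_times_n_limit_0 LIMSEQ_power_zero)
  then have "(\<lambda>n. (real n + 1) * (1/c) ^ n) \<longlonglongrightarrow> 0" by (simp add: algebra_simps)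
  moreover have "(real n + 1) * (1/c) ^ n \<ge> 1" for n
    using assms(2)[of n] \<open>\<not> c \<le> 1\<close> by (simp add: field_simps)
  ultimately have "(0::real) \<ge> 1" by (intro tendsto_lowerbound) auto
  then show False by simp
qed

section \<open>Splitting over an algebraically closed subfield\<close>

text \<open>Synthetic division: coefficient n of \<open>S\<close> equals coefficient n + 1 of the
  product plus \<open>a\<close> times coefficient n + 1 of \<open>S\<close>, so the coefficients are
  recovered from the top downwards.\<close>

lemma coeff_quotient_linear_in_subfield:
  assumes "is_subfield E" "a \<in> E" "\<forall>i. coeff ([:-a, 1:] * S) i \<in> E"
  shows "coeff S i \<in> E"
proof (cases "i \<le> degree S")
  case True
  then show ?thesis
  proof (induction i rule: inc_induct)
    case base
    have "coeff ([:-a, 1:] * S) (Suc (degree S)) \<in> E" using assms by blast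
    then show ?case by (simp add: coeff_eq_0)
  next
    case (step n)
    have "coeff ([:-a, 1:] * S) (Suc n) \<in> E" using assms by blast
    then have "coeff ([:-a, 1:] * S) (Suc n) + a * coeff S (Suc n) \<in> E"
      using assms(1,2) step.IH unfolding is_subfield_def by blast
    then show ?case by simp
  qed
next
  case False
  then show ?thesis using assms by (simp add: coeff_eq_0 is_subfield_def)
qed

text \<open>The subfield is a set so that the result serves both for a dense subfield, in
  \<open>root_in_completion\<close>, and for \<open>UNIV\<close>, in
  \<open>monic_splits\<close>.\<close>

lemma monic_splits_over_subfield:
  fixes Q :: "'a::field poly"
  assumes E: "is_subfield E"
    and root: "\<And>Q. degree Q > 0 \<Longrightarrow> \<forall>i. coeff Q i \<in> E \<Longrightarrow> \<exists>x\<in>E. poly Q x = 0"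
    and "lead_coeff Q = 1" "\<forall>i. coeff Q i \<in> E"
  shows "\<exists>as. length as = degree Q \<and> set as \<subseteq> E \<and> Q = (\<Prod>a\<leftarrow>as. [:-a, 1:])"
  using assms(3,4)
proof (induction "degree Q" arbitrary: Q)
  case 0
  then have "Q = 1" using degree_eq_zeroE[of Q] by (metis lead_coeff_pCons(2) one_pCons)
  then show ?case by auto
next
  case (Suc n)
  then obtain a where a: "a \<in> E" "poly Q a = 0" using root[of Q] by auto
  then obtain S where S: "Q = [:-a, 1:] * S" by (metis poly_eq_0_iff_dvd dvdE)
  have "S \<noteq> 0" using S Suc by auto
  have lead: "lead_coeff S = 1"
    using Suc.prems(1) unfolding S lead_coeff_mult by simp
  have deg: "degree Q = Suc (degree S)"
    using \<open>S \<noteq> 0\<close> unfolding S by (subst degree_mult_eq) auto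
  have "\<forall>i. coeff S i \<in> E"
    using coeff_quotient_linear_in_subfield[OF E a(1)] Suc.prems(2) unfolding S by blast
  then obtain as where "length as = degree S" "set as \<subseteq> E" "S = (\<Prod>a\<leftarrow>as. [:-a, 1:])"
    using Suc.hyps(1)[of S] Suc.hyps(2) deg lead by auto
  then show ?case using S deg a by (intro exI[of _ "a # as"]) auto
qed

lemma poly_prod_list_linear:
  "poly (\<Prod>a\<leftarrow>as. [:-a, 1:]) z = (\<Prod>a\<leftarrow>as. z - (a :: 'a :: comm_ring_1))"
  by (induction as) (auto simp: algebra_simps)

lemma degree_minus_const:
  "degree P > 0 \<Longrightarrow> degree (P - [:c:]) = degree (P :: 'a::comm_ring_1 poly)"
  by (subst diff_conv_add_uminus, subst degree_add_eq_left) auto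

lemma lead_coeff_minus_const:
  "degree P > 0 \<Longrightarrow> lead_coeff (P - [:c:]) = lead_coeff (P :: 'a::comm_ring_1 poly)"
  by (simp add: degree_minus_const coeff_pCons split: nat.split)

section \<open>Fields with an absolute value\<close>

locale abs_valued_field =
  fixes v :: "'a::field \<Rightarrow> real"
  assumes absolute_value: "absolute_value v"
begin

lemma v_nonneg [simp]: "0 \<le> v x"
  and v_eq_0_iff [simp]: "v x = 0 \<longleftrightarrow> x = 0"
  and v_mult: "v (x * y) = v x * v y"
  and v_triangle: "v (x + y) \<le> v x + v y"
  using absolute_value by (auto simp: absolute_value_def)

lemma v_zero [simp]: "v 0 = 0" by simp

lemma v_one [simp]: "v 1 = 1"
  using v_mult[of 1 1] by (metis v_eq_0_iff mult_cancel_left1 mult_1 one_neq_zero)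

lemma v_power: "v (x ^ n) = v x ^ n"
  by (induction n) (auto simp: v_mult)

lemma v_minus [simp]: "v (- x) = v x"
proof -
  have "v (- 1) ^ 2 = 1" using v_power[of "-1" 2] by simp
  then have "v (- 1) = 1" using v_nonneg[of "-1"] by (simp add: power2_eq_1_iff)
  then show ?thesis using v_mult[of "-1" x] by simp
qed

lemma v_diff_commute: "v (x - y) = v (y - x)"
  using v_minus[of "x - y"] by simp

lemma v_sum_le: "v (sum g A) \<le> (\<Sum>i\<in>A. v (g i))"
proof (induction A rule: infinite_finite_induct)
  case (insert i A)
  then show ?case using v_triangle[of "g i" "sum g A"] by simp
qed auto

lemma v_prod_list: "v (prod_list xs) = prod_list (map v xs)"
  by (induction xs) (auto simp: v_mult)

sublocale Metric_space UNIV "av_dist v"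
proof
  show "v (x - z) \<le> v (x - y) + v (y - z)" for x y z
    using v_triangle[of "x - y" "y - z"] by simp
qed (auto intro: v_diff_commute)

section \<open>Bounds for polynomials and roots in a completion\<close>

lemma poly_lipschitz_on_bounded:
  assumes "0 \<le> R"
  shows "\<exists>C\<ge>0. \<forall>x y. v x \<le> R \<and> v y \<le> R \<longrightarrow> v (poly P x - poly P y) \<le> C * v (x - y)"
proof (induction P)
  case 0
  then show ?case by (intro exI[of _ 0]) auto
next
  case (pCons c P)
  then obtain C where C: "C \<ge> 0"
    "\<And>x y. v x \<le> R \<Longrightarrow> v y \<le> R \<Longrightarrow> v (poly P x - poly P y) \<le> C * v (x - y)" by blast
  \<comment> \<open>A bound for \<open>P\<close> on the disk of radius \<open>R\<close>, by
    comparison with the value at 0. It is needed for the first term of the product-rule splitting of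
    the Horner form below.\<close>
  define B where "B = v (poly P 0) + C * R"
  have B: "v (poly P x) \<le> B" if "v x \<le> R" for x
  proof -
    have "v (poly P x) \<le> v (poly P x - poly P 0) + v (poly P 0)"
      using v_triangle[of "poly P x - poly P 0" "poly P 0"] by simp
    also have "v (poly P x - poly P 0) \<le> C * v x" using C(2)[of x 0] that assms by simp
    also have "\<dots> \<le> C * R" using that C by (intro mult_left_mono)
    finally show ?thesis by (simp add: B_def)
  qed
  have "v (poly (pCons c P) x - poly (pCons c P) y) \<le> (B + R * C) * v (x - y)"
    if "v x \<le> R" "v y \<le> R" for x y
  proof -
    have "v (poly (pCons c P) x - poly (pCons c P) y)
      = v ((x - y) * poly P x + y * (poly P x - poly P y))" by (simp add: algebra_simps)
    also have "\<dots> \<le> v (x - y) * v (poly P x) + v y * v (poly P x - poly P y)"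
      using v_triangle by (metis v_mult)
    also have "\<dots> \<le> v (x - y) * B + R * (C * v (x - y))"
      using that B C(2)[of x y] assms by (intro add_mono mult_mono) auto
    finally show ?thesis by (simp add: algebra_simps)
  qed
  moreover have "B + R * C \<ge> 0" using C assms by (simp add: B_def)
  ultimately show ?case by (intro exI[of _ "B + R * C"]) auto
qed

text \<open>Cauchy's bound: for |w| > 1 the leading power is minus the sum of the d lower terms,
  each at most B |w|^(d-1), and |w|^(d-1) cancels.\<close>

lemma monic_root_bound:
  fixes B :: real
  assumes Q: "lead_coeff Q = 1" and B: "\<And>i. v (coeff Q i) \<le> B" and "poly Q w = 0"
  shows "v w \<le> max 1 (degree Q * B)"
proof (cases "v w \<le> 1")
  case False
  let ?d = "degree Q"
  have "?d \<noteq> 0"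
    using Q assms(3) degree_eq_zeroE[of Q] by fastforce
  then obtain e where e: "?d = Suc e" by (cases ?d) auto
  have "B \<ge> 0" using B[of 0] v_nonneg order_trans by blast
  have "poly Q w = (\<Sum>i<?d. coeff Q i * w ^ i) + w ^ ?d"
    using Q by (simp add: poly_altdef lessThan_Suc_atMost[symmetric])
  then have "w ^ ?d = - (\<Sum>i<?d. coeff Q i * w ^ i)" using assms(3) by (simp add: eq_neg_iff_add_eq_0 add.commute)
  then have "v w ^ ?d = v (\<Sum>i<?d. coeff Q i * w ^ i)" by (metis v_power v_minus)
  also have "\<dots> \<le> (\<Sum>i<?d. v (coeff Q i * w ^ i))" by (rule v_sum_le)
  also have "\<dots> \<le> (\<Sum>i<?d. B * v w ^ e)"
    using B \<open>B \<ge> 0\<close> False e unfolding v_mult v_power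
    by (intro sum_mono mult_mono power_increasing) auto
  finally have "v w * v w ^ e \<le> (?d * B) * v w ^ e" by (simp add: e algebra_simps)
  then have "v w \<le> ?d * B" using False by (simp add: mult_le_cancel_right)
  then show ?thesis by simp
qed simp

text \<open>The value at \<open>z\<close> is the product of the distances from \<open>z\<close> to
  the roots, so the least distance is at most their geometric mean.\<close>

lemma nearby_root:
  assumes "Q = (\<Prod>a\<leftarrow>as. [:-a, 1:])" "as \<noteq> []"
  shows "\<exists>w. poly Q w = 0 \<and> v (z - w) ^ length as \<le> v (poly Q z)"
proof -
  obtain w where w: "w \<in> set as" "v (z - w) ^ length as \<le> prod_list (map (\<lambda>a. v (z - a)) as)"
    using prod_list_ge_power_elem[of "map (\<lambda>a. v (z - a)) as"] assms(2) by auto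
  moreover have "prod_list (map (\<lambda>a. v (z - a)) as) = v (poly Q z)"
    by (simp add: assms(1) poly_prod_list_linear v_prod_list o_def)
  moreover have "poly Q w = 0"
    using w(1) by (auto simp: assms(1) poly_prod_list_linear prod_list_zero_iff)
  ultimately show ?thesis by auto
qed

text \<open>
  From an approximate root \<open>z\<close> of \<open>P\<close> pass to the nearest root of a polynomial over the dense
  subfield whose coefficients are close to those of \<open>P\<close>; iterating gives a Cauchy sequence.
\<close>

lemma root_in_completion:
  assumes E: "is_subfield E"
    and root: "\<And>Q. degree Q > 0 \<Longrightarrow> \<forall>i. coeff Q i \<in> E \<Longrightarrow> \<exists>x\<in>E. poly Q x = 0"
    and complete: "mcomplete"
    and dense: "mtopology closure_of E = UNIV"
    and P: "lead_coeff (P :: 'a poly) = 1" "degree P > 0"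
  shows "\<exists>z. poly P z = 0"
proof -
  let ?d = "degree P"
  have approx: "\<exists>b\<in>E. v (b - a) < e" if "e > 0" for a e
  proof -
    have "a \<in> mtopology closure_of E" using dense by auto
    then show ?thesis using that by (auto simp: metric_closure_of in_mball v_diff_commute)
  qed
  \<comment> \<open>The summand 1 leaves room to perturb every coefficient by at most 1, so that
    \<open>R\<close> bounds the roots of all the perturbed polynomials at once.\<close>
  define B where "B = (\<Sum>i\<le>?d. v (coeff P i)) + 1"
  define R where "R = max 1 (?d * B)"
  have R: "R \<ge> 1" by (simp add: R_def)
  have coeffB: "v (coeff P i) + 1 \<le> B" for i
  proof (cases "i \<le> ?d")
    case True
    then show ?thesis unfolding B_def by (intro add_right_mono member_le_sum) auto
  next
    case False
    then show ?thesis by (simp add: B_def coeff_eq_0 sum_nonneg)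
  qed
  have step: "\<exists>w. v w \<le> R \<and> v (poly P w) \<le> e \<and> v (w - z) ^ ?d \<le> v (poly P z) + e"
    if z: "v z \<le> R" and e: "e > 0" for z e
  proof -
    \<comment> \<open>Changing the d + 1 coefficients by at most \<open>\<delta>\<close> changes the
      values on the disk of radius \<open>R\<close> by at most (d + 1) \<open>\<delta>\<close>
      \<open>R\<close>^d.\<close>
    define \<delta> where "\<delta> = min 1 (e / ((real ?d + 1) * R ^ ?d))"
    have den: "(real ?d + 1) * R ^ ?d > 0" using R by auto
    have \<delta>: "\<delta> > 0" "\<delta> \<le> 1" "\<delta> * ((real ?d + 1) * R ^ ?d) \<le> e"
      using e den pos_le_divide_eq[OF den, of \<delta> e] by (auto simp: \<delta>_def)
    have "\<forall>i. \<exists>b. b \<in> E \<and> v (b - coeff P i) < \<delta>" using approx[OF \<delta>(1)] by blast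
    then obtain b where b: "\<And>i. b i \<in> E" "\<And>i. v (b i - coeff P i) < \<delta>" by metis
    \<comment> \<open>The leading coefficient 1 already lies in \<open>E\<close> and is kept, so
      that the perturbed polynomial stays monic of the same degree.\<close>
    define c where "c = (\<lambda>i. if i < ?d then b i else coeff P i)"
    define Q where "Q = Abs_poly c"
    have coeffQ: "coeff Q i = c i" for i
      unfolding Q_def by (subst coeff_Abs_poly[of ?d]) (auto simp: c_def coeff_eq_0)
    have degQ: "degree Q = ?d"
    proof (rule antisym)
      show "degree Q \<le> ?d" by (intro degree_le) (auto simp: coeffQ c_def coeff_eq_0)
      show "?d \<le> degree Q" using P by (intro le_degree) (auto simp: coeffQ c_def)
    qed
    have lead: "lead_coeff Q = 1" using P by (simp add: degQ coeffQ c_def)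
    have "coeff P i \<in> E" if "i \<ge> ?d" for i
      using that P E by (cases "i = ?d") (auto simp: coeff_eq_0 is_subfield_def)
    then have inE: "\<forall>i. coeff Q i \<in> E" using b by (auto simp: coeffQ c_def)
    have close: "v (coeff Q i - coeff P i) \<le> \<delta>" for i
      using b(2)[of i] \<delta> by (auto simp: coeffQ c_def)
    have Qbound: "v (coeff Q i) \<le> B" for i
      using v_triangle[of "coeff Q i - coeff P i" "coeff P i"] close[of i] coeffB[of i] \<delta> by simp
    have PQ: "v (poly P x - poly Q x) \<le> e" if "v x \<le> R" for x
    proof -
      have "poly P x - poly Q x = (\<Sum>i\<le>?d. (coeff P i - coeff Q i) * x ^ i)"
        by (simp add: poly_altdef degQ sum_subtractf[symmetric] algebra_simps)
      then have "v (poly P x - poly Q x) \<le> (\<Sum>i\<le>?d. v ((coeff P i - coeff Q i) * x ^ i))"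
        by (metis v_sum_le)
      also have "\<dots> \<le> (\<Sum>i\<le>?d. \<delta> * R ^ ?d)"
      proof (intro sum_mono)
        fix i assume i: "i \<in> {..?d}"
        have "v x ^ i \<le> R ^ i" using that by (intro power_mono) auto
        also have "\<dots> \<le> R ^ ?d" using R i by (intro power_increasing) auto
        finally show "v ((coeff P i - coeff Q i) * x ^ i) \<le> \<delta> * R ^ ?d"
          using close[of i] \<delta>(1) unfolding v_mult v_power
          by (subst v_diff_commute) (intro mult_mono, auto)
      qed
      also have "\<dots> = \<delta> * ((real ?d + 1) * R ^ ?d)" by (simp add: algebra_simps)
      finally show ?thesis using \<delta>(3) by linarith
    qed
    obtain as where as: "length as = ?d" "Q = (\<Prod>a\<leftarrow>as. [:-a, 1:])"
      using monic_splits_over_subfield[OF E root lead inE] degQ by auto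
    then have "as \<noteq> []" using P(2) by auto
    then obtain w where w: "poly Q w = 0" "v (z - w) ^ ?d \<le> v (poly Q z)"
      using nearby_root[OF as(2), of z] as(1) by auto
    have wR: "v w \<le> R" using monic_root_bound[OF lead Qbound w(1)] by (simp add: degQ R_def)
    have "v (poly P w) \<le> e" using PQ[OF wR] w by simp
    moreover have "v (poly Q z) \<le> v (poly P z) + e"
      using v_triangle[of "poly P z" "poly Q z - poly P z"] PQ[OF z]
        v_diff_commute[of "poly P z" "poly Q z"] by simp
    ultimately show ?thesis using wR w v_diff_commute[of z w] by (intro exI[of _ w]) auto
  qed
  \<comment> \<open>Two successive errors add up to at most (1/2)^(n d), whose d-th root (1/2)^n
    bounds the n-th step; these bounds are summable.\<close>
  define \<epsilon> where "\<epsilon> = (\<lambda>n. (1/2) ^ (n * ?d) / 2 :: real)"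
  have \<epsilon>: "\<epsilon> n > 0" for n by (simp add: \<epsilon>_def)
  have "\<exists>z. \<forall>n. (v (z n) \<le> R \<and> v (poly P (z n)) \<le> \<epsilon> n) \<and>
      v (z (Suc n) - z n) ^ ?d \<le> \<epsilon> n + \<epsilon> (Suc n)"
  proof (rule dependent_nat_choice)
    show "\<exists>z. v z \<le> R \<and> v (poly P z) \<le> \<epsilon> 0" using step[of 0, OF _ \<epsilon>[of 0]] R by auto
    show "\<exists>y. (v y \<le> R \<and> v (poly P y) \<le> \<epsilon> (Suc n)) \<and> v (y - x) ^ ?d \<le> \<epsilon> n + \<epsilon> (Suc n)"
      if "v x \<le> R \<and> v (poly P x) \<le> \<epsilon> n" for x n
      using step[of x, OF _ \<epsilon>[of "Suc n"]] that by force
  qed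
  then obtain z where z: "\<And>n. v (z n) \<le> R" "\<And>n. v (poly P (z n)) \<le> \<epsilon> n"
    "\<And>n. v (z (Suc n) - z n) ^ ?d \<le> \<epsilon> n + \<epsilon> (Suc n)" by blast
  have zstep: "v (z (Suc n) - z n) \<le> (1/2) ^ n" for n
  proof -
    have "\<epsilon> (Suc n) \<le> \<epsilon> n"
      unfolding \<epsilon>_def by (intro divide_right_mono power_decreasing) auto
    then have "v (z (Suc n) - z n) ^ ?d \<le> ((1/2) ^ n) ^ ?d"
      using z(3)[of n] by (simp add: \<epsilon>_def power_mult)
    then show ?thesis using P(2) by (simp add: power_mono_iff)
  qed
  \<comment> \<open>The right-hand side is the exact partial geometric sum, which is what makes the
    induction on \<open>k\<close> close.\<close>
  have ztail: "v (z (n + k) - z n) \<le> 2 * (1/2) ^ n - 2 * (1/2) ^ (n + k)" for n k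
  proof (induction k)
    case (Suc k)
    have "v (z (n + Suc k) - z n) \<le> v (z (Suc (n + k)) - z (n + k)) + v (z (n + k) - z n)"
      using v_triangle[of "z (Suc (n + k)) - z (n + k)" "z (n + k) - z n"] by simp
    with Suc zstep[of "n + k"] show ?case by simp
  qed simp
  have "MCauchy z"
    unfolding MCauchy_def
  proof (intro conjI allI impI)
    fix e :: real assume "e > 0"
    then obtain N where N: "(1/2) ^ N < e / 2" using real_arch_pow_inv[of "e/2" "1/2"] by auto
    have ordered: "v (z m - z n) < e" if "N \<le> n" "n \<le> m" for m n
    proof -
      have "v (z m - z n) \<le> 2 * (1/2) ^ n" using ztail[of n "m - n"] that
        by (smt (verit) le_add_diff_inverse zero_le_power zero_le_divide_1_iff)
      also have "(1/2::real) ^ n \<le> (1/2) ^ N" using that by (intro power_decreasing) auto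
      finally show ?thesis using N by simp
    qed
    show "\<exists>N. \<forall>n n'. N \<le> n \<longrightarrow> N \<le> n' \<longrightarrow> v (z n - z n') < e"
      using ordered v_diff_commute by (metis nat_le_linear)
  qed simp
  then obtain y where y: "limitin mtopology z y sequentially"
    using complete by (auto simp: mcomplete_def)
  then have dist: "(\<lambda>n. v (z n - y)) \<longlonglongrightarrow> 0"
    by (simp add: limitin_metric_dist_null)
  \<comment> \<open>Enlarged so that the Lipschitz estimate covers the limit \<open>y\<close> as
    well as the \<open>z n\<close>.\<close>
  define R' where "R' = max R (v y)"
  then have "0 \<le> R'" using R by simp
  obtain C where C: "\<And>a b. v a \<le> R' \<Longrightarrow> v b \<le> R' \<Longrightarrow> v (poly P a - poly P b) \<le> C * v (a - b)"
    using poly_lipschitz_on_bounded[of R' P] \<open>0 \<le> R'\<close> by blast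
  have \<epsilon>0: "\<epsilon> n \<le> (1/2) ^ n" for n
  proof -
    have "(1/2::real) ^ (n * ?d) \<le> (1/2) ^ n" using P(2) by (intro power_decreasing) auto
    moreover have "(0::real) \<le> (1/2) ^ n" by simp
    ultimately show ?thesis unfolding \<epsilon>_def by linarith
  qed
  have le: "v (poly P y) \<le> C * v (z n - y) + (1/2) ^ n" for n
  proof -
    have "v (poly P y) \<le> v (poly P y - poly P (z n)) + v (poly P (z n))"
      using v_triangle[of "poly P y - poly P (z n)" "poly P (z n)"] by simp
    also have "v (poly P y - poly P (z n)) \<le> C * v (y - z n)"
      using z(1)[of n] by (intro C) (auto simp: R'_def)
    finally show ?thesis using z(2)[of n] \<epsilon>0[of n] v_diff_commute[of y "z n"] by simp
  qed
  have "(\<lambda>n. C * v (z n - y) + (1/2) ^ n) \<longlonglongrightarrow> C * 0 + 0"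
    by (intro tendsto_intros dist LIMSEQ_power_zero) auto
  then have "v (poly P y) \<le> C * 0 + 0" by (rule tendsto_lowerbound) (auto intro: le always_eventually)
  then show ?thesis using v_nonneg[of "poly P y"] by (auto intro!: exI[of _ y])
qed

text \<open>Binomial coefficients have absolute value at most 1, so expanding gives |x + y|^n \<le>
  (n + 1) M^n with M = max |x| |y|; letting n grow removes n + 1.\<close>

lemma ultrametric:
  assumes "\<And>n. v (of_nat n) \<le> 1"
  shows "v (x + y) \<le> max (v x) (v y)"
proof (cases "max (v x) (v y) = 0")
  case True
  then show ?thesis using v_nonneg[of x] v_nonneg[of y] v_triangle[of x y] by linarith
next
  case False
  define M where "M = max (v x) (v y)"
  have M: "M > 0" using False v_nonneg[of x] v_nonneg[of y] unfolding M_def by linarith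
  have "(v (x + y) / M) ^ n \<le> real n + 1" for n
  proof -
    have "v (x + y) ^ n = v (\<Sum>k\<le>n. of_nat (n choose k) * x ^ k * y ^ (n - k))"
      by (simp add: v_power[symmetric] binomial_ring)
    also have "\<dots> \<le> (\<Sum>k\<le>n. v (of_nat (n choose k) * x ^ k * y ^ (n - k)))" by (rule v_sum_le)
    also have "\<dots> \<le> (\<Sum>k\<le>n. 1 * M ^ k * M ^ (n - k))"
      unfolding v_mult v_power using M assms
      by (intro sum_mono mult_mono power_mono) (auto simp: M_def)
    also have "\<dots> = (real n + 1) * M ^ n"
      by (simp add: power_add[symmetric] algebra_simps)
    finally show ?thesis using M by (simp add: power_divide field_simps)
  qed
  then have "v (x + y) / M \<le> 1" using M by (intro powers_le_linear_imp_le_1) auto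
  then show ?thesis using M by (simp add: M_def)
qed

end

section \<open>Disks and filled Julia sets over an algebraically closed ultrametric field\<close>

locale ultrametric_closed_field = abs_valued_field v for v :: "'a::field \<Rightarrow> real" +
  assumes ultra: "\<And>x y. v (x + y) \<le> max (v x) (v y)"
    and has_root: "\<And>P :: 'a poly. lead_coeff P = 1 \<Longrightarrow> degree P > 0 \<Longrightarrow> \<exists>z. poly P z = 0"
    and nontrivial: "\<exists>\<pi>. v \<pi> > 1"
begin

lemma ultra_diff: "v (x - z) \<le> max (v (x - y)) (v (y - z))"
  using ultra[of "x - y" "y - z"] by simp

lemma monic_splits:
  assumes "lead_coeff (Q :: 'a poly) = 1"
  obtains as where "length as = degree Q" "Q = (\<Prod>a\<leftarrow>as. [:-a, 1:])"
proof -
  have "\<exists>x\<in>UNIV. poly S x = 0" if "degree S > 0" for S :: "'a poly"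
  proof -
    have "S \<noteq> 0" using that by auto
    then show ?thesis using has_root[of "smult (inverse (lead_coeff S)) S"] that by auto
  qed
  then show ?thesis
    using monic_splits_over_subfield[of UNIV Q] assms that by (auto simp: is_subfield_def)
qed

text \<open>A suitable root \<open>u\<close> of an element of value above 1 satisfies 1 < |u| \<le>
  t/s. Its powers grow by factors of at most t/s, so the first one to exceed \<open>s\<close> cannot
  jump over \<open>t\<close>.\<close>

lemma value_between:
  assumes "1 \<le> s" "s < t"
  obtains y where "s < v y" "v y \<le> t"
proof -
  obtain \<pi> where \<pi>: "v \<pi> > 1" using nontrivial by blast
  obtain n where n: "v \<pi> < (t / s) ^ n" using real_arch_pow[of "t / s" "v \<pi>"] assms by auto
  have n0: "n > 0" using n \<pi> by (cases n) auto
  have "\<exists>u. poly (monom 1 n - [:\<pi>:]) u = 0"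
    using n0 by (intro has_root)
      (auto simp: degree_minus_const degree_monom_eq coeff_pCons split: nat.splits)
  then obtain u where "u ^ n = \<pi>" by (auto simp: poly_monom)
  then have u: "v u ^ n = v \<pi>" by (metis v_power)
  have u1: "v u > 1" using u \<pi> by (metis linorder_not_le v_nonneg power_le_one)
  have "v u ^ n \<le> (t / s) ^ n" using u n by simp
  then have ut: "v u \<le> t / s" using n0 assms by (subst (asm) power_mono_iff) auto
  define k where "k = (LEAST k. s < v u ^ k)"
  have "\<exists>k. s < v u ^ k" using real_arch_pow[OF u1] by blast
  then have k: "s < v u ^ k" unfolding k_def by (rule LeastI_ex)
  then obtain j where j: "k = Suc j" using assms by (cases k) auto
  have "\<not> s < v u ^ j" using not_less_Least[of j "\<lambda>k. s < v u ^ k"] j by (simp add: k_def)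
  then have "v u * v u ^ j \<le> (t / s) * s" using ut assms by (intro mult_mono) auto
  then show ?thesis using k j assms by (intro that[of "u ^ k"]) (simp_all add: v_power v_mult)
qed

text \<open>
  Minimality of the disk is stated by inclusion of disks; density of the value group turns it into
  a comparison of radii.
\<close>

lemma min_disk_radius_le:
  assumes "is_min_disk_radius v S r" "S \<subseteq> closed_disk v b s" "1 \<le> s"
  shows "r \<le> s"
proof (rule ccontr)
  assume "\<not> r \<le> s"
  \<comment> \<open>The points \<open>a\<close> and \<open>a + y\<close> will both lie in the disk
    of radius \<open>s\<close>, although they are more than \<open>s\<close> apart.\<close>
  then obtain y where y: "s < v y" "v y \<le> r" using value_between[of s r] assms by auto
  obtain a where "closed_disk v a r \<subseteq> closed_disk v b s" and r: "r > 0"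
    using assms unfolding is_min_disk_radius_def
    by (meson less_le_trans zero_less_one)
  then have "\<And>x. v (x - a) \<le> r \<Longrightarrow> v (x - b) \<le> s" by (auto simp: closed_disk_def)
  moreover have "v (a - a) \<le> r" "v (a + y - a) \<le> r" using r y by auto
  ultimately have "v (a - b) \<le> s" "v (a + y - b) \<le> s" by blast+
  then show False using ultra_diff[of "a + y" a b] y v_diff_commute[of a b] by simp
qed

lemma min_disk_radius_diam:
  assumes "is_min_disk_radius v S r" "x \<in> S" "y \<in> S"
  shows "v (x - y) \<le> r"
proof -
  obtain a where "S \<subseteq> closed_disk v a r" using assms by (auto simp: is_min_disk_radius_def)
  then have "v (x - a) \<le> r" "v (y - a) \<le> r" using assms by (auto simp: closed_disk_def)
  then show ?thesis using ultra_diff[of x y a] v_diff_commute[of y a] by simp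
qed

text \<open>Dropping the first term of an orbit does not affect its divergence. Hence the set
  contains all preimages of its points.\<close>

lemma image_mem_filled_julia_iff: "f x \<in> filled_julia v f \<longleftrightarrow> x \<in> filled_julia v f"
proof -
  have "filterlim (\<lambda>n. v ((f ^^ n) (f x))) at_top sequentially
      \<longleftrightarrow> filterlim (\<lambda>n. v ((f ^^ Suc n) x)) at_top sequentially"
    by (simp add: funpow_swap1)
  also have "\<dots> \<longleftrightarrow> filterlim (\<lambda>n. v ((f ^^ n) x)) at_top sequentially"
    by (rule filterlim_sequentially_Suc)
  finally show ?thesis by (simp add: filled_julia_def)
qed

text \<open>The bound keeps \<open>v (poly F x - w)\<close> because it is estimated by
  \<open>r\<close> for the first inclusion and by 1 for the second.\<close>

lemma preimage_near_point:
  assumes F: "lead_coeff F = 1" "degree F \<ge> 2"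
    and r: "is_min_disk_radius v (filled_julia v (poly F)) r" "r > 1"
    and w: "w \<in> filled_julia v (poly F)" and x: "x \<in> filled_julia v (poly F)"
  obtains y where "poly F y = w" "v (x - y) ^ (degree F - 1) \<le> v (poly F x - w) / r"
proof -
  let ?K = "filled_julia v (poly F)" and ?d = "degree F"
  have deg: "degree (F - [:w:]) = ?d" and "lead_coeff (F - [:w:]) = 1"
    using F lead_coeff_minus_const[of F w] by (auto simp: degree_minus_const)
  then obtain as where as: "length as = ?d" "F - [:w:] = (\<Prod>a\<leftarrow>as. [:-a, 1:])"
    using monic_splits deg by metis
  have Fw: "poly F z - w = (\<Prod>a\<leftarrow>as. z - a)" for z
    using arg_cong[OF as(2), of "\<lambda>q. poly q z"] by (simp add: poly_prod_list_linear)
  have vF: "v (poly F z - w) = prod_list (map (\<lambda>a. v (z - a)) as)" for z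
    by (simp add: Fw v_prod_list o_def)
  have root: "poly F a = w" if "a \<in> set as" for a
    using that Fw[of a] by (metis (no_types, lifting) prod_list_zero_iff eq_iff_diff_eq_0 image_eqI list.set_map)
  have "\<exists>a\<in>set as. r \<le> v (x - a)"
  proof (rule ccontr)
    assume "\<not> ?thesis"
    then have near: "v (x - a) < r" if "a \<in> set as" for a using that by force
    \<comment> \<open>The radius of a disk around \<open>x\<close> that is too small for the filled
      Julia set. Since \<open>r > 1\<close> and the degree is at least 2, also
      \<open>root ?d r\<close> lies strictly between 1 and \<open>r\<close>.\<close>
    define s where "s = Max (insert (root ?d r) ((\<lambda>a. v (x - a)) ` set as))"
    have s: "root ?d r \<le> s" "\<And>a. a \<in> set as \<Longrightarrow> v (x - a) \<le> s" by (auto simp: s_def)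
    have "root ?d r < r"
      using r F real_root_strict_decreasing[of 1 ?d r] by simp
    then have "s < r" unfolding s_def using near by (subst Max_less_iff) auto
    have "root ?d r > 1" using r F by simp
    then have "s \<ge> 1" using s(1) by linarith
    have "?K \<subseteq> closed_disk v x s"
    proof
      fix z assume z: "z \<in> ?K"
      show "z \<in> closed_disk v x s"
      proof (rule ccontr)
        assume "\<not> ?thesis"
        then have far: "v (z - x) > s" by (simp add: closed_disk_def)
        \<comment> \<open>As |x - a| \<le> s < |z - x|, the ultrametric inequality prevents
          \<open>z\<close> from being closer to \<open>a\<close> than to \<open>x\<close>.\<close>
        have "v (z - x) \<le> v (z - a)" if "a \<in> set as" for a
          using ultra_diff[of z x a] s(2)[OF that] far v_diff_commute[of x a] by linarith
        then have "v (z - x) ^ ?d \<le> v (poly F z - w)"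
          unfolding vF using prod_list_ge_power[of "v (z - x)" "map (\<lambda>a. v (z - a)) as"] as(1) by auto
        \<comment> \<open>Both \<open>poly F z\<close> and \<open>w\<close> lie in the filled Julia
          set, whose diameter is at most \<open>r\<close>.\<close>
        also have "\<dots> \<le> r"
          using z w image_mem_filled_julia_iff by (intro min_disk_radius_diam[OF r(1)]) auto
        also have "\<dots> = root ?d r ^ ?d" using r F by simp
        finally have "v (z - x) \<le> root ?d r"
          using F r by (subst (asm) power_mono_iff) auto
        then show False using far s(1) by linarith
      qed
    qed
    then show False using min_disk_radius_le[OF r(1)] \<open>s < r\<close> \<open>s \<ge> 1\<close> by force
  qed
  then obtain y where "y \<in> set as" "v (x - y) ^ (?d - 1) \<le> v (poly F x - w) / r"
    unfolding vF using prod_list_remove_elem[of "map (\<lambda>a. v (x - a)) as" _ r] F r as(1)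
    by auto
  then show ?thesis using that root by blast
qed

end

section \<open>The p-adic complex numbers\<close>

lemma padic_abs_of_nat_le_1:
  assumes "prime p"
  shows "padic_abs p (of_nat n) \<le> 1"
proof -
  have "quotient_of (of_nat n) = (int n, 1)" using quotient_of_int[of "int n"] by simp
  moreover have "real p powi (- int k) \<le> 1" for k
    using prime_ge_1_nat[OF assms] by (simp add: power_int_minus field_simps)
  ultimately show ?thesis by (simp add: padic_abs_def)
qed

lemma padic_abs_self:
  assumes "prime p"
  shows "padic_abs p (of_nat p) = 1 / real p"
proof -
  have "quotient_of (of_nat p) = (int p, 1)" using quotient_of_int[of "int p"] by simp
  moreover have "multiplicity (int p) (int p) = 1"
    using assms by (intro multiplicity_self) auto
  ultimately show ?thesis using assms by (auto simp: padic_abs_def power_int_minus field_simps)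
qed

text \<open>The ultrametric inequality comes from the bound on the natural numbers, the roots from
  the dense algebraically closed subfield, and 1/p has value p > 1.\<close>

lemma is_padic_complex_ultrametric_closed:
  fixes v :: "'a::field_char_0 \<Rightarrow> real"
  assumes p: "prime p" and "is_padic_complex p v"
  shows "ultrametric_closed_field v"
proof -
  obtain Qp E where v: "absolute_value v" and rat: "\<And>q. v (of_rat q) = padic_abs p q"
    and E: "is_algebraic_closure Qp E" and UNIV: "is_completion v E UNIV"
    using assms(2) unfolding is_padic_complex_def by blast
  interpret abs_valued_field v using v by unfold_locales
  show ?thesis
  proof
    have "v (of_nat n) \<le> 1" for n
      using rat[of "of_nat n"] padic_abs_of_nat_le_1[OF p, of n] by simp
    then show "v (x + y) \<le> max (v x) (v y)" for x y by (rule ultrametric)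
    show "\<exists>z. poly P z = 0" if "lead_coeff P = 1" "degree P > 0" for P :: "'a poly"
      using E UNIV that unfolding is_algebraic_closure_def is_completion_def
      by (intro root_in_completion[of E P]) auto
    have vp: "v (of_nat p) = 1 / real p" using rat[of "of_nat p"] padic_abs_self[OF p] by simp
    have "v (inverse (of_nat p)) * v (of_nat p) = 1"
      using v_mult[of "inverse (of_nat p)" "of_nat p"] p by simp
    then have "v (inverse (of_nat p)) = real p" using vp p by (simp add: field_simps)
    then show "\<exists>\<pi>. v \<pi> > 1" using prime_gt_1_nat[OF p] by (intro exI[of _ "inverse (of_nat p)"]) simp
  qed
qed

theorem lemma2p1:
  fixes p d :: nat and v :: "'a::field_char_0 \<Rightarrow> real"
    and P :: "rat poly" and f :: "'a \<Rightarrow> 'a" and r :: real and x\<^sub>0 :: 'a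
  assumes "prime p" and "is_padic_complex p v"
    and "lead_coeff P = 1" and "degree P = d" and "d \<ge> 2"
    and "f = poly (map_poly of_rat P)"
    and "is_min_disk_radius v (filled_julia v f) r"
    and "x\<^sub>0 \<in> filled_julia v f"
  shows "filled_julia v f \<subseteq> (\<Union>x\<in>{x. f x = x\<^sub>0}. closed_disk v x 1) \<and>
         filled_julia v f \<subseteq> (\<Union>x\<in>{x. (f ^^ 2) x = x\<^sub>0}. closed_disk v x (r powr (- 1 / real d)))"
proof -
  interpret ultrametric_closed_field v
    using is_padic_complex_ultrametric_closed assms(1,2) .
  define F :: "'a poly" where "F = map_poly of_rat P"
  have f: "f = poly F" using assms(6) by (simp add: F_def)
  have deg: "degree F = d" using assms(4) unfolding F_def by (simp add: degree_map_poly)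
  have lead: "lead_coeff F = 1"
    unfolding deg using assms(3,4) by (simp add: F_def coeff_map_poly)
  let ?K = "filled_julia v f"
  have r0: "r > 0" using assms(7) by (simp add: is_min_disk_radius_def)
  have memK: "f y \<in> ?K \<longleftrightarrow> y \<in> ?K" for y by (rule image_mem_filled_julia_iff)
  have cover: "?K \<subseteq> (\<Union>x\<in>{x. g x = x\<^sub>0}. closed_disk v x t)"
    if "\<And>x. x \<in> ?K \<Longrightarrow> \<exists>y. g y = x\<^sub>0 \<and> v (x - y) \<le> t" for g t
    using that by (fastforce simp: closed_disk_def)
  have f2: "(f ^^ 2) y = f (f y)" for y by (simp add: numeral_2_eq_2)
  show ?thesis
  proof (cases "r > 1")
    case True
    have near: "\<exists>y. f y = w \<and> v (x - y) ^ (d - 1) \<le> v (f x - w) / r" if "w \<in> ?K" "x \<in> ?K" for w x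
      using preimage_near_point[of F r w x] lead deg assms(5,7) True that unfolding f by blast
    have near1: "\<exists>y. f y = x\<^sub>0 \<and> v (x - y) \<le> 1" if "x \<in> ?K" for x
    proof -
      obtain y where y: "f y = x\<^sub>0" "v (x - y) ^ (d - 1) \<le> v (f x - x\<^sub>0) / r"
        using near[OF assms(8) \<open>x \<in> ?K\<close>] by blast
      have "v (f x - x\<^sub>0) \<le> r"
        using that assms(8) memK by (intro min_disk_radius_diam[OF assms(7)]) auto
      then have "v (f x - x\<^sub>0) / r \<le> 1" using r0 by simp
      then have "v (x - y) ^ (d - 1) \<le> 1 ^ (d - 1)" using y(2) by simp
      then have "v (x - y) \<le> 1" using assms(5) by (subst (asm) power_mono_iff) auto
      then show ?thesis using y by blast
    qed
    have near2: "\<exists>y. f (f y) = x\<^sub>0 \<and> v (x - y) \<le> r powr (- 1 / real d)" if x: "x \<in> ?K" for x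
    proof -
      obtain w where w: "f w = x\<^sub>0" "v (f x - w) \<le> 1"
        using near1[OF memK[THEN iffD2, OF x]] by blast
      then have "w \<in> ?K" using memK[of w] assms(8) by simp
      then obtain y where y: "f y = w" "v (x - y) ^ (d - 1) \<le> v (f x - w) / r"
        using near[OF _ x] by blast
      let ?t = "v (x - y)"
      have t: "?t ^ (d - 1) \<le> 1 / r"
        using y(2) w(2) r0 by (meson divide_right_mono less_imp_le order_trans)
      also have "\<dots> \<le> 1 ^ (d - 1)" using True by simp
      finally have "?t \<le> 1" using assms(5) by (subst (asm) power_mono_iff) auto
      \<comment> \<open>Since \<open>?t\<close> is at most 1, the exponent d - 1 may be raised to d,
        which yields the exponent -1/d of the radius.\<close>
      then have "?t ^ d \<le> ?t ^ (d - 1)" by (intro power_decreasing) auto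
      also note t
      also have "1 / r = (r powr (- 1 / real d)) ^ d"
        using r0 assms(5) powr_power[of r "- 1 / real d" d] powr_minus_divide[of r 1] by simp
      finally have "?t \<le> r powr (- 1 / real d)"
        using assms(5) by (subst (asm) power_mono_iff) auto
      then show ?thesis using y w by blast
    qed
    show ?thesis using cover[OF near1] cover[of "f ^^ 2"] near2 by (simp add: f2)
  next
    case False
    \<comment> \<open>For \<open>r \<le> 1\<close> both radii are at least 1, hence at least
      \<open>r\<close>, so a single disk around one preimage, itself in the filled Julia set,
      suffices.\<close>
    have surj: "\<exists>y. f y = c" for c
      using has_root[of "F - [:c:]"] lead deg assms(5) lead_coeff_minus_const[of F c]
      by (auto simp: f degree_minus_const)
    obtain y where y: "f y = x\<^sub>0" using surj by blast
    obtain u where u: "f u = y" using surj by blast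
    have K: "y \<in> ?K" "u \<in> ?K" using memK[of y] memK[of u] y u assms(8) by auto
    have "r powr (- 1 / real d) \<ge> 1"
      using False r0 by (simp add: powr_minus_divide powr_le1)
    moreover have "v (x - y) \<le> r" "v (x - u) \<le> r" if "x \<in> ?K" for x
      using min_disk_radius_diam[OF assms(7)] that K by blast+
    ultimately have "v (x - y) \<le> 1" "v (x - u) \<le> r powr (- 1 / real d)" if "x \<in> ?K" for x
      using that False by force+
    then show ?thesis
      using cover[of f 1] cover[of "f ^^ 2" "r powr (- 1 / real d)"] y u f2 by blast
  qed
qed

end
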